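(* For every $n\ge 1$, the map $\Phi$ (defined in the context) is well defined, i.e. for every snake $\pi$ of type $B_n$ the pair $\Phi(\pi)=(P;W)$ is a labeled ballot path of length $n$, and $\Phi$ is a bijection from the set of snakes of type $B_n$ onto the set of labeled ballot paths of length $n$.
   Context: A signed permutation of $[n]=\{1,\dots,n\}$ is a word $\pi=\pi_1\cdots\pi_n$ obtained from a permutation of $[n]$ by giving some entries a minus sign; $-i$ is written $\bar i$. Signed entries are compared in the order $\bar n<\cdots<\bar 1<1<\cdots<n$. A snake of type $B_n$ is a signed permutation with $0<\pi_1>\pi_2<\pi_3>\pi_4<\cdots\pi_n$ (alternating relations throughout). A ballot path of length $n$ is a lattice path from $(0,0)$ with $n$ steps, each an up step $u=(1,1)$ or a down step $d=(1,-1)$, never going below the $x$-axis. The height of a step is the smaller of the $y$-coordinates of its two endpoints. A labeled ballot path $(P;W)$, $P=p_1\cdots p_n$, $W=w_1\cdots w_n$, is a ballot path in which each step $p_i$ carries an integer label $w_i$ with $0\le w_i\le$ height of $p_i$. Inversion code: for a snake $\pi$ of type $B_n$ and $1\le i\le n$, if $n$ is odd let $c_i(\pi)$ be the number of $k$ with $1\le k\le (n-1)/2$, $i<2k$ and $\pi_{2k}<\pi_i<\pi_{2k+1}$; if $n$ is even let $c_i(\pi)$ be the number of $k$ with $1\le k\le n/2$, $i<2k-1$ and $\pi_{2k}<\pi_i<\pi_{2k-1}$. The map $\Phi$: given a snake $\pi$ of type $B_n$, define $p_1,\dots,p_n$ and $w_1,\dots,w_n$ successively for $k=1,\dots,n$: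 let $i$ be the position with $\pi_i\in\{n-k+1,\overline{n-k+1}\}$. If $\pi_i=n-k+1$, set $p_k=u$ if $i$ is odd and $p_k=d$ if $i$ is even, and set $w_k=c_i(\pi)$. If $\pi_i=\overline{n-k+1}$, set $p_k=d$ if $i$ is odd and $p_k=u$ if $i$ is even, and set $w_k=h_k-c_i(\pi)$, where $h_k$ is the height of the $k$-th step in the path $p_1\cdots p_k$. Then $\Phi(\pi)=(p_1\cdots p_n;w_1\cdots w_n)$. *)

theory Defs
  imports Main
begin

(* Signed permutations of [n] are int lists; entry -i encodes \bar i.
   The order \bar n < ... < \bar 1 < 1 < ... < n is the usual order on int.
   Positions are 1-indexed: ent pi i = pi_i = pi ! (i-1). *)

definition ent :: "int list \<Rightarrow> nat \<Rightarrow> int" where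
  "ent \<pi> i = \<pi> ! (i - 1)"

definition signed_perm :: "nat \<Rightarrow> int list \<Rightarrow> bool" where
  "signed_perm n \<pi> \<longleftrightarrow> length \<pi> = n \<and> distinct (map abs \<pi>) \<and> set (map abs \<pi>) = {1..int n}"

definition snake :: "nat \<Rightarrow> int list \<Rightarrow> bool" where
  "snake n \<pi> \<longleftrightarrow> signed_perm n \<pi> \<and> (n \<ge> 1 \<longrightarrow> 0 < ent \<pi> 1) \<and>
     (\<forall>i. 1 \<le> i \<and> i < n \<longrightarrow>
        (if odd i then ent \<pi> i > ent \<pi> (i+1) else ent \<pi> i < ent \<pi> (i+1)))"

(* Paths: True = up step u, False = down step d. ypos P k = y-coordinate after k steps. *)
definition ypos :: "bool list \<Rightarrow> nat \<Rightarrow> int" where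
  "ypos P k = (\<Sum>j<k. if P ! j then 1 else -1)"

(* height of the k-th step (1-indexed) *)
definition height :: "bool list \<Rightarrow> nat \<Rightarrow> int" where
  "height P k = min (ypos P (k - 1)) (ypos P k)"

definition ballot_path :: "nat \<Rightarrow> bool list \<Rightarrow> bool" where
  "ballot_path n P \<longleftrightarrow> length P = n \<and> (\<forall>k\<le>n. 0 \<le> ypos P k)"

definition labeled_ballot_path :: "nat \<Rightarrow> bool list \<times> int list \<Rightarrow> bool" where
  "labeled_ballot_path n PW \<longleftrightarrow> (case PW of (P, W) \<Rightarrow>
     ballot_path n P \<and> length W = n \<and>
     (\<forall>k\<in>{1..n}. 0 \<le> W ! (k - 1) \<and> W ! (k - 1) \<le> height P k))"

definition inv_code :: "nat \<Rightarrow> int list \<Rightarrow> nat \<Rightarrow> nat" where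
  "inv_code n \<pi> i =
     (if odd n then card {k. 1 \<le> k \<and> k \<le> (n - 1) div 2 \<and> i < 2*k \<and>
                            ent \<pi> (2*k) < ent \<pi> i \<and> ent \<pi> i < ent \<pi> (2*k+1)}
      else card {k. 1 \<le> k \<and> k \<le> n div 2 \<and> i < 2*k - 1 \<and>
                            ent \<pi> (2*k) < ent \<pi> i \<and> ent \<pi> i < ent \<pi> (2*k - 1)})"

definition posn :: "int list \<Rightarrow> int \<Rightarrow> nat" where
  "posn \<pi> v = (THE i. 1 \<le> i \<and> i \<le> length \<pi> \<and> \<bar>ent \<pi> i\<bar> = v)"

definition Phi_path :: "nat \<Rightarrow> int list \<Rightarrow> bool list" where
  "Phi_path n \<pi> = map (\<lambda>k. let i = posn \<pi> (int (n - k + 1)) in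
                          (if 0 < ent \<pi> i then odd i else even i)) [1..<n+1]"

(* h_k is the height of the k-th step of p_1...p_k, equal to its height in the full path *)
definition Phi :: "nat \<Rightarrow> int list \<Rightarrow> bool list \<times> int list" where
  "Phi n \<pi> = (let P = Phi_path n \<pi> in
     (P, map (\<lambda>k. let i = posn \<pi> (int (n - k + 1)) in
                 (if 0 < ent \<pi> i then int (inv_code n \<pi> i)
                  else height (take k P) k - int (inv_code n \<pi> i))) [1..<n+1]))"

end

theory Submission
  imports Defs "HOL-Library.Multiset"
begin

text \<open>
  Process the absolute values of a snake in the order \<open>n, n - 1, \<dots>, 1\<close>. Once the values above \<open>v\<close>
  have been read, collapse every maximal run of consecutive entries of the same sign and of absolute
  value above \<open>v\<close> to a single limit entry \<open>\<plusminus>M\<close>, where \<open>M > n\<close>, with an additional limit entry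
  placed after \<open>\<pi>\<^sub>n\<close> (positive iff \<open>n\<close> is even). All runs have odd length, so the collapsed word is
  again alternating, and the current height of the path is one less than its number of limit entries.
  An up step is a single entry turning into a new limit entry, a down step merges the two limit
  entries of equal sign around an entry.

  Going backwards, a limit entry is expanded by replacing it by \<open>\<plusminus>v\<close> (up step; the additional entry
  is excluded) or by splitting it around \<open>\<plusminus>v\<close> (down step). Rank the limit entries: the positive ones
  from right to left, then the negative ones from left to right. The label of the step is exactly the
  rank of the chosen entry, lowered by one for up steps if \<open>n\<close> is even, since then the additional
  entry has rank 0. Hence labels within the height of the step correspond bijectively to the possible
  expansions, and the theorem follows by induction on \<open>v\<close>.

  Words are stored from right to left, so that the additional limit entry comes first and the
  inversion code of an entry only depends on the part of the list before it.
\<close>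

section \<open>Alternating words\<close>

text \<open>The flag tells whether the first entry is a peak; the virtual final valley 0 encodes
  \<open>0 < \<pi>\<^sub>1\<close>.\<close>

fun alternating :: "bool \<Rightarrow> 'a::{linorder,zero} list \<Rightarrow> bool" where
  "alternating e [] \<longleftrightarrow> \<not> e"
| "alternating e (x # xs) \<longleftrightarrow>
     (if e then hd (xs @ [0]) < x else x < hd (xs @ [0])) \<and> alternating (\<not> e) xs"

lemma hd_snoc_in: "hd (xs @ [y]) \<in> insert y (set xs)"
  by (cases xs) auto

lemma alternating_odd_length: "alternating e xs \<Longrightarrow> e \<longleftrightarrow> odd (length xs)"
  by (induction xs arbitrary: e) auto

lemma alternating_suffix:
  "alternating e (A @ B) \<Longrightarrow> alternating (e = even (length A)) B"
proof (induction A arbitrary: e)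
  case (Cons a A)
  then have "alternating ((\<not> e) = even (length A)) B" by simp
  moreover have "((\<not> e) = even (length A)) = (e = even (length (a # A)))" by auto
  ultimately show ?case by simp
qed simp

lemma alternating_next:
  assumes "alternating e (A @ x # B)"
  shows "if e = even (length A) then hd (B @ [0]) < x else x < hd (B @ [0])"
  using alternating_suffix[OF assms] by simp

lemma alternating_replace:
  assumes "alternating e (A @ x # B)"
    and "\<And>z. z \<in> insert 0 (set A \<union> set B) \<Longrightarrow>
      if e = even (length A) then z < x \<longrightarrow> z < y else x < z \<longrightarrow> y < z"
  shows "alternating e (A @ y # B)"
  using assms
proof (induction A arbitrary: e)
  case Nil
  then show ?case using hd_snoc_in[of B 0] by (auto split: if_splits)
next
  case (Cons a A)
  have "alternating (\<not> e) (A @ y # B)"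
  proof (rule Cons.IH)
    show "alternating (\<not> e) (A @ x # B)" using Cons.prems(1) by simp
    show "if (\<not> e) = even (length A) then z < x \<longrightarrow> z < y else x < z \<longrightarrow> y < z"
      if "z \<in> insert 0 (set A \<union> set B)" for z
      using Cons.prems(2)[of z] that by (cases e; cases "even (length A)"; auto)
  qed
  moreover have "if e then hd (A @ y # B @ [0]) < a else a < hd (A @ y # B @ [0])"
    using Cons.prems(1) Cons.prems(2)[of a]
    by (cases A) (auto split: if_splits)
  ultimately show ?case by simp
qed

lemma alternating_triple:
  "alternating e (A @ b # x # b # B) \<longleftrightarrow>
     alternating e (A @ b # B) \<and> (if e = even (length A) then x < b else b < x)"
  by (induction A arbitrary: e) (auto simp: hd_append)

lemma alternating_rev_iff:
  "alternating e (rev xs) \<longleftrightarrow> e = odd (length xs) \<and>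
     (\<forall>j<length xs. if even j then (0 # xs) ! j < xs ! j else xs ! j < (0 # xs) ! j)"
proof (induction xs arbitrary: e rule: rev_induct)
  case (snoc x xs)
  have "hd (rev xs @ [0]) = (0 # xs) ! length xs"
    by (induction xs rule: rev_induct) (auto simp: nth_append)
  moreover have "(0 # xs @ [x]) ! j = (0 # xs) ! j" if "j \<le> length xs" for j
    using that by (cases j) (auto simp: nth_append)
  ultimately show ?case
    by (auto simp: snoc.IH All_less_Suc nth_append)
qed simp

fun limit_word :: "'a::linordered_idom \<Rightarrow> bool \<Rightarrow> nat \<Rightarrow> 'a list" where
  "limit_word M e 0 = []"
| "limit_word M e (Suc t) = (if e then M else - M) # limit_word M (\<not> e) t"

lemma alternating_limit_word:
  "0 < M \<Longrightarrow> alternating (odd t) (limit_word M (odd t) t)"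
proof (induction t)
  case (Suc t)
  then show ?case by (cases t) auto
qed simp

lemma map_abs_limit_word: "0 \<le> M \<Longrightarrow> map abs (limit_word M e t) = replicate t M"
  by (induction t arbitrary: e) auto

lemma alternating_extremal_eq_limit_word:
  assumes "alternating e xs" "\<forall>z\<in>set xs. \<bar>z\<bar> = M"
  shows "xs = limit_word M e (length xs)"
  using assms
proof (induction xs arbitrary: e)
  case (Cons x xs)
  then have "xs = limit_word M (\<not> e) (length xs)" by auto
  moreover have "\<bar>hd (xs @ [0])\<bar> \<le> M" using Cons.prems(2) hd_snoc_in[of xs 0] by auto
  then have "x = (if e then M else - M)"
    using Cons.prems by (auto split: if_splits)
  ultimately show ?case by simp
qed simp

lemma alternating_extremal_parity:
  fixes T :: "'a::linordered_idom"
  assumes "alternating e (A @ T # B)" "\<forall>z\<in>set B. \<bar>z\<bar> \<le> \<bar>T\<bar>" "T \<noteq> 0"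
  shows "(e \<longleftrightarrow> 0 < T) \<longleftrightarrow> even (length A)"
proof -
  have "\<bar>hd (B @ [0])\<bar> \<le> \<bar>T\<bar>" using assms(2) hd_snoc_in[of B 0] by auto
  then show ?thesis
    using alternating_next[OF assms(1)] assms(3) by (auto split: if_splits)
qed

lemma alternating_neighbours:
  assumes "alternating e (A @ a # x # B)"
  shows "if e = even (length A) then x < a \<and> x < hd (B @ [0]) else a < x \<and> hd (B @ [0]) < x"
  using alternating_suffix[OF assms] by (auto split: if_splits)

section \<open>Counting crossings\<close>

fun unequal_pairs :: "'a list \<Rightarrow> nat" where
  "unequal_pairs (a # b # r) = of_bool (a \<noteq> b) + unequal_pairs r"
| "unequal_pairs [] = 0"
| "unequal_pairs [a] = 0"

lemmas unequal_pairs_induct = unequal_pairs.induct[case_names pair empty single]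

lemma unequal_pairs_map: "inj_on f (set xs) \<Longrightarrow> unequal_pairs (map f xs) = unequal_pairs xs"
  by (induction xs rule: unequal_pairs_induct) (auto simp: inj_on_def)

lemma unequal_pairs_triple: "unequal_pairs (A @ b # b # b # B) = unequal_pairs (A @ b # B)"
  by (induction A rule: unequal_pairs_induct) auto

lemma unequal_pairs_snoc: "even (length xs) \<Longrightarrow> unequal_pairs (xs @ [b]) = unequal_pairs xs"
  by (induction xs rule: unequal_pairs_induct) auto

lemma unequal_pairs_eq_card:
  "unequal_pairs xs = card {m. Suc m < length xs \<and> even m \<and> xs ! m \<noteq> xs ! Suc m}"
proof (induction xs rule: unequal_pairs_induct)
  case (pair a b r)
  let ?S = "\<lambda>xs. {m. Suc m < length xs \<and> even m \<and> xs ! m \<noteq> xs ! Suc m}"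
  have "?S (a # b # r) = (if a = b then {} else {0}) \<union> (Suc \<circ> Suc) ` ?S r"
  proof (intro set_eqI)
    fix m
    consider "m = 0" | "m = 1" | l where "m = Suc (Suc l)" by (metis One_nat_def not0_implies_Suc)
    then show "m \<in> ?S (a # b # r) \<longleftrightarrow> m \<in> (if a = b then {} else {0}) \<union> (Suc \<circ> Suc) ` ?S r"
      by cases auto
  qed
  moreover have "finite (?S r)" by (rule finite_subset[of _ "{..<length r}"]) auto
  then have "card ((if a = b then {} else {0}) \<union> (Suc \<circ> Suc) ` ?S r) =
      of_bool (a \<noteq> b) + card (?S r)"
    by (auto simp: card_image card_insert_if inj_on_def)
  ultimately show ?case using pair by simp
qed auto

text \<open>Neighbours in an alternating word differ, so no pair contains \<open>T\<close> twice.\<close>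

lemma unequal_pairs_extremal:
  fixes T :: "'a::linordered_idom"
  assumes "alternating e (A @ R)" "\<forall>z\<in>set (A @ R). \<bar>z\<bar> \<le> \<bar>T\<bar>" "T \<noteq> 0"
    and "even (length A) \<or> e \<noteq> (0 < T)"
  shows "unequal_pairs (map (\<lambda>z. z = T) A) = count_list A T"
  using assms(1,2,4)
proof (induction A arbitrary: e rule: unequal_pairs_induct)
  case (pair a b r)
  have "unequal_pairs (map (\<lambda>z. z = T) r) = count_list r T"
    using pair.prems by (intro pair.IH[of e]) (auto split: if_splits)
  moreover have "a \<noteq> b" using pair.prems(1) by (auto split: if_splits)
  ultimately show ?case by auto
next
  case (single a)
  then have "a \<noteq> T"
    using alternating_extremal_parity[of e "[]" T R] assms(3) by auto
  then show ?case by simp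
qed simp

lemma unequal_pairs_before_extremal:
  fixes T :: "'a::linordered_idom"
  assumes alt: "alternating e (A @ T # B)" and bounded: "\<forall>z\<in>set (A @ T # B). \<bar>z\<bar> \<le> \<bar>T\<bar>"
    and "T \<noteq> 0" and hd: "hd (A @ [T]) = (if e then \<bar>T\<bar> else - \<bar>T\<bar>)" and "p \<longrightarrow> A \<noteq> []"
  shows "int (unequal_pairs (map (\<lambda>z. z = T) (tl (A @ (if p then [] else [T]))))) =
    int (count_list A T) - of_bool (p \<and> e = (0 < T))"
proof (cases A)
  case Nil
  then show ?thesis using assms(5) by auto
next
  case (Cons a A')
  have parity: "(e \<longleftrightarrow> 0 < T) \<longleftrightarrow> odd (length A')"
    using alternating_extremal_parity[OF alt _ assms(3)] bounded Cons by simp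
  have head: "a = T \<longleftrightarrow> e = (0 < T)" using hd assms(3) Cons by auto
  have tail: "unequal_pairs (map (\<lambda>z. z = T) A') = count_list A' T"
    using alt bounded parity assms(3) Cons
    by (intro unequal_pairs_extremal[of "\<not> e" _ "T # B"]) auto
  show ?thesis
  proof (cases p)
    case True
    then show ?thesis using Cons head tail by simp
  next
    case False
    have "unequal_pairs (map (\<lambda>z. z = T) (A' @ [T])) = count_list A T"
    proof (cases "e = (0 < T)")
      case True
      then show ?thesis
        using unequal_pairs_extremal[of "\<not> e" "A' @ [T]" B T] alt bounded parity assms(3) Cons head
        by simp
    next
      case False
      then show ?thesis using Cons head tail parity by (simp add: unequal_pairs_snoc)
    qed
    then show ?thesis using False Cons by simp
  qed
qed

lemma unequal_pairs_less_limit: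
  fixes T :: "'a::linordered_idom"
  assumes "\<forall>z\<in>set L. \<bar>z\<bar> = \<bar>T\<bar> \<or> \<bar>z\<bar> < k" "0 \<le> k" "k < \<bar>T\<bar>"
  shows "unequal_pairs (map (\<lambda>z. sgn T * k < z) L) = unequal_pairs (map (\<lambda>z. z = T) L)"
proof (cases "0 < T")
  case True
  then have "map (\<lambda>z. sgn T * k < z) L = map (\<lambda>z. z = T) L"
    using assms by (auto simp: abs_if split: if_splits)
  then show ?thesis by (rule arg_cong)
next
  case False
  then have "map (\<lambda>z. sgn T * k < z) L = map Not (map (\<lambda>z. z = T) L)"
    using assms by (fastforce simp: sgn_if abs_if split: if_splits)
  then show ?thesis by (simp add: unequal_pairs_map inj_on_def del: map_map)
qed

lemma count_list_split:
  "r < count_list xs y \<Longrightarrow> \<exists>A B. xs = A @ y # B \<and> count_list A y = r"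
proof (induction xs arbitrary: r)
  case (Cons x xs)
  consider (here) "x = y" "r = 0" | (later) r' where "x = y" "r = Suc r'" | (skip) "x \<noteq> y"
    by (cases r) auto
  then show ?case
  proof cases
    case here
    then show ?thesis by (intro exI[of _ "[]"] exI[of _ xs]) simp
  next
    case (later r')
    then obtain A B where "xs = A @ y # B" "count_list A y = r'"
      using Cons.IH[of r'] Cons.prems by auto
    then show ?thesis using later by (intro exI[of _ "x # A"] exI[of _ B]) simp
  next
    case skip
    then obtain A B where "xs = A @ y # B" "count_list A y = r"
      using Cons.IH[of r] Cons.prems by auto
    then show ?thesis using skip by (intro exI[of _ "x # A"] exI[of _ B]) simp
  qed
qed simp

lemma count_list_split_unique:
  "A @ y # B = A' @ y # B' \<Longrightarrow> count_list A y = count_list A' y \<Longrightarrow> A = A' \<and> B = B'"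
proof (induction A arbitrary: A')
  case Nil
  then show ?case by (cases A') auto
next
  case (Cons a A)
  then show ?case by (cases A') (auto split: if_splits)
qed

lemma count_mset_map_abs:
  fixes M :: "'a::linordered_idom"
  shows "0 < M \<Longrightarrow> count (mset (map abs xs)) M = count_list xs M + count_list xs (- M)"
  by (induction xs) auto

section \<open>Words with limit entries\<close>

text \<open>The values above \<open>v\<close> have been collapsed, and \<open>y\<close> is the current height of the path.\<close>

definition collapsed_word :: "int \<Rightarrow> bool \<Rightarrow> nat \<Rightarrow> nat \<Rightarrow> int list \<Rightarrow> bool" where
  "collapsed_word M e v y s \<longleftrightarrow>
     mset (map abs s) = mset_set {1..int v} + replicate_mset (Suc y) M \<and>
     alternating e s \<and> \<bar>hd s\<bar> = M"

lemma collapsed_word_abs: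
  assumes "collapsed_word M e v y s" "z \<in> set s"
  shows "\<bar>z\<bar> = M \<or> 1 \<le> \<bar>z\<bar> \<and> \<bar>z\<bar> \<le> int v"
proof -
  have "\<bar>z\<bar> \<in># mset (map abs s)" using assms(2) by simp
  then have "\<bar>z\<bar> \<in># mset_set {1..int v} + replicate_mset (Suc y) M"
    using assms(1) unfolding collapsed_word_def by metis
  then show ?thesis by (auto split: if_splits)
qed

lemma collapsed_word_abs_le:
  assumes "collapsed_word M e v y s" "int v < M" "z \<in> set s"
  shows "\<bar>z\<bar> \<le> M"
  using collapsed_word_abs[OF assms(1,3)] assms(2) by auto

lemma count_limit_entries:
  assumes "collapsed_word M e v y s" "int v < M"
  shows "count_list s M + count_list s (- M) = Suc y"
proof -
  have "count (mset (map abs s)) M = Suc y"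
    using assms unfolding collapsed_word_def by simp
  then show ?thesis using count_mset_map_abs[of M s] assms(2) by simp
qed

lemma limit_entry_parity:
  assumes "collapsed_word M e v y (A @ T # B)" "\<bar>T\<bar> = M" "int v < M"
  shows "(e \<longleftrightarrow> 0 < T) \<longleftrightarrow> even (length A)"
  using alternating_extremal_parity[of e A T B] collapsed_word_abs_le[OF assms(1,3)] assms
  by (auto simp: collapsed_word_def)

lemma collapsed_word_Cons:
  assumes "collapsed_word M e v y s" "int v < M"
  obtains r where "s = (if e then M else - M) # r"
proof -
  have "mset (map abs s) \<noteq> {#}" using assms(1) by (simp add: collapsed_word_def)
  then obtain x r where s: "s = x # r" by (cases s) auto
  moreover have "\<bar>x\<bar> = M" using assms(1) s by (simp add: collapsed_word_def)
  moreover from this have "e \<longleftrightarrow> 0 < x"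
    using limit_entry_parity[of M e v y "[]" x r] assms s by simp
  ultimately show ?thesis using that assms(2) by (auto simp: abs_if split: if_splits)
qed

lemma collapsed_word_zero_iff:
  assumes "0 < M"
  shows "collapsed_word M e 0 y s \<longleftrightarrow> e = even y \<and> s = limit_word M e (Suc y)"
proof
  assume s: "collapsed_word M e 0 y s"
  have "\<forall>z\<in>set s. \<bar>z\<bar> = M" using collapsed_word_abs[OF s] by force
  moreover have "size (mset (map abs s)) = Suc y" using s by (simp add: collapsed_word_def)
  then have "length s = Suc y" by simp
  moreover have "alternating e s" using s by (simp add: collapsed_word_def)
  ultimately show "e = even y \<and> s = limit_word M e (Suc y)"
    using alternating_extremal_eq_limit_word[of e s M] alternating_odd_length[of e s]
    by (simp del: limit_word.simps)
next
  assume "e = even y \<and> s = limit_word M e (Suc y)"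
  then have e: "e = odd (Suc y)" and s: "s = limit_word M e (Suc y)" by auto
  have "mset (map abs s) = replicate_mset (Suc y) M"
    unfolding s using assms by (simp only: map_abs_limit_word less_imp_le mset_replicate)
  moreover have "alternating e s"
    unfolding s e by (rule alternating_limit_word[OF assms])
  moreover have "\<bar>hd s\<bar> = M"
    unfolding s using assms by simp
  ultimately show "collapsed_word M e 0 y s" by (simp add: collapsed_word_def)
qed

section \<open>Ranks of limit entries\<close>

text \<open>The rank of the entry \<open>T\<close> following \<open>A\<close> in a word with \<open>y + 1\<close> limit entries: positive limit
  entries come first, in the order of the word, then the negative ones in the opposite order.\<close>

definition limit_rank :: "nat \<Rightarrow> int list \<Rightarrow> int \<Rightarrow> int" where
  "limit_rank y A T = (if 0 < T then int (count_list A T) else int y - int (count_list A T))"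

lemma limit_rank_bounds:
  assumes "count_list (A @ T # B) M + count_list (A @ T # B) (- M) = Suc y" "\<bar>T\<bar> = M" "0 < M"
  shows "0 \<le> limit_rank y A T" "limit_rank y A T \<le> int y"
  using assms by (auto simp: limit_rank_def abs_if split: if_splits)

lemma limit_rank_unique:
  assumes "count_list s M + count_list s (- M) = Suc y" "0 < M"
    and "s = A @ T # B" "s = A' @ T' # B'" "\<bar>T\<bar> = M" "\<bar>T'\<bar> = M"
    and rank: "limit_rank y A T = limit_rank y A' T'"
  shows "A = A' \<and> T = T' \<and> B = B'"
proof -
  have "count_list A T < count_list s T" "count_list A' T' < count_list s T'"
    by (simp add: assms(3)) (simp add: assms(4))
  then have T: "T = T'"
    using assms(1,2,5,6) rank by (auto simp: limit_rank_def abs_if split: if_splits)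
  then have "count_list A T = count_list A' T"
    using rank by (auto simp: limit_rank_def split: if_splits)
  then show ?thesis using count_list_split_unique[of A T B A' B'] assms(3,4) T by simp
qed

lemma limit_rank_exists:
  assumes "count_list s M + count_list s (- M) = Suc y" "0 < M" "0 \<le> r" "r \<le> int y"
  obtains A T B where "s = A @ T # B" "\<bar>T\<bar> = M" "limit_rank y A T = r"
proof (cases "r < int (count_list s M)")
  case True
  then obtain A B where "s = A @ M # B" "count_list A M = nat r"
    using count_list_split[of "nat r" s M] assms(3) by (metis nat_less_iff)
  then show ?thesis using that[of A M B] assms by (simp add: limit_rank_def)
next
  case False
  then have "nat (int y - r) < count_list s (- M)" using assms by linarith
  then obtain A B where "s = A @ (- M) # B" "count_list A (- M) = nat (int y - r)"
    using count_list_split by metis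
  then show ?thesis using that[of A "- M" B] assms by (simp add: limit_rank_def)
qed

lemma limit_rank_first_iff:
  assumes "collapsed_word M e v y (A @ T # B)" "\<bar>T\<bar> = M" "int v < M"
  shows "limit_rank y A T = (if e then 0 else int y) \<longleftrightarrow> A = []"
proof -
  obtain r where r: "A @ T # B = [] @ (if e then M else - M) # r"
    using collapsed_word_Cons[OF assms(1,3)] by auto
  have M: "0 < M" using assms(3) by simp
  then have first: "limit_rank y [] (if e then M else - M) = (if e then 0 else int y)"
    by (simp add: limit_rank_def)
  show ?thesis
  proof
    assume "limit_rank y A T = (if e then 0 else int y)"
    then show "A = []"
      using limit_rank_unique[OF count_limit_entries[OF assms(1,3)] M refl r assms(2)] M first
      by (simp split: if_splits)
  next
    assume "A = []"
    then show "limit_rank y A T = (if e then 0 else int y)" using r first by simp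
  qed
qed

section \<open>Expansions\<close>

definition expansion :: "'a::linordered_idom \<Rightarrow> bool \<Rightarrow> 'a \<Rightarrow> 'a list" where
  "expansion k p T = (if p then [sgn T * k] else [T, sgn T * k, T])"

text \<open>In \<open>expand M e v h s' p w s\<close>, a limit entry of \<open>s'\<close> is expanded by the value \<open>v + 1\<close>,
  which yields \<open>s\<close>; this corresponds to a step of height \<open>h\<close> with label \<open>w\<close>. The condition
  \<open>A \<noteq> []\<close> protects the additional limit entry.\<close>

inductive expand :: "int \<Rightarrow> bool \<Rightarrow> nat \<Rightarrow> nat \<Rightarrow> int list \<Rightarrow> bool \<Rightarrow> int \<Rightarrow> int list \<Rightarrow> bool"
  for M e v h where
  expandI: "\<bar>T\<bar> = M \<Longrightarrow> p \<longrightarrow> A \<noteq> [] \<Longrightarrow>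
    expand M e v h (A @ T # B) p (limit_rank (h + of_bool p) A T - of_bool (p \<and> e))
      (A @ expansion (int (Suc v)) p T @ B)"

lemma alternating_expansion_iff:
  fixes T :: "'a::linordered_idom"
  assumes "0 < k" "k < \<bar>T\<bar>" "\<forall>z\<in>set A \<union> set B. \<bar>z\<bar> = \<bar>T\<bar> \<or> \<bar>z\<bar> < k"
    and "(e \<longleftrightarrow> 0 < T) \<longleftrightarrow> even (length A)"
  shows "alternating e (A @ expansion k p T @ B) \<longleftrightarrow> alternating e (A @ T # B)"
proof (cases p)
  case True
  let ?x = "sgn T * k"
  have bounded: "\<bar>z\<bar> = \<bar>T\<bar> \<or> \<bar>z\<bar> < k" if "z \<in> insert 0 (set A \<union> set B)" for z
    using that assms(1,3) by auto
  have "if e = even (length A) then z < T \<longleftrightarrow> z < ?x else T < z \<longleftrightarrow> ?x < z"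
    if "z \<in> insert 0 (set A \<union> set B)" for z
    using bounded[OF that] assms(1,2,4) by (auto simp: sgn_if abs_if split: if_splits)
  then have "alternating e (A @ ?x # B) \<longleftrightarrow> alternating e (A @ T # B)"
    using alternating_replace[of e A T B ?x] alternating_replace[of e A ?x B T]
    by (smt (verit))
  then show ?thesis using True by (simp add: expansion_def)
next
  case False
  have "if e = even (length A) then sgn T * k < T else T < sgn T * k"
    using assms(1,2,4) by (auto simp: sgn_if abs_if split: if_splits)
  then show ?thesis
    using False by (simp add: expansion_def alternating_triple)
qed

lemma collapsed_word_expansion_iff:
  assumes "int (Suc v) < M" "\<bar>T\<bar> = M" "p \<longrightarrow> A \<noteq> []" "(e \<longleftrightarrow> 0 < T) \<longleftrightarrow> even (length A)"
  shows "collapsed_word M e (Suc v) (h + of_bool (\<not> p)) (A @ expansion (int (Suc v)) p T @ B) \<longleftrightarrow>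
    collapsed_word M e v (h + of_bool p) (A @ T # B)"
    (is "collapsed_word _ _ _ _ ?s \<longleftrightarrow> collapsed_word _ _ _ _ ?s'")
proof -
  let ?mset' = "mset_set {1..int v} + replicate_mset (Suc (h + of_bool p)) M"
  have "{1..int (Suc v)} = insert (int (Suc v)) {1..int v}" by auto
  moreover have "\<bar>sgn T * int (Suc v)\<bar> = int (Suc v)" using assms(1,2) by (simp add: abs_mult)
  ultimately have mset: "mset (map abs ?s) =
      mset_set {1..int (Suc v)} + replicate_mset (Suc (h + of_bool (\<not> p))) M \<longleftrightarrow>
      mset (map abs ?s') = ?mset'"
    using assms(2) by (cases p) (simp_all add: expansion_def)
  have "alternating e ?s \<longleftrightarrow> alternating e ?s'" if "mset (map abs ?s') = ?mset'"
  proof (rule alternating_expansion_iff)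
    have "\<bar>z\<bar> \<in># ?mset'" if "z \<in> set A \<union> set B" for z
      using that unfolding \<open>mset (map abs ?s') = ?mset'\<close>[symmetric] by auto
    then show "\<forall>z\<in>set A \<union> set B. \<bar>z\<bar> = \<bar>T\<bar> \<or> \<bar>z\<bar> < int (Suc v)"
      using assms(2) by (fastforce split: if_splits)
  qed (use assms in auto)
  moreover have "\<bar>hd ?s\<bar> = \<bar>hd ?s'\<bar>"
    using assms(3) by (cases A) (auto simp: expansion_def)
  ultimately show ?thesis
    unfolding collapsed_word_def mset by auto
qed

lemma expand_collapsed_word:
  assumes "expand M e v h s' p w s" "collapsed_word M e v (h + of_bool p) s'" "int (Suc v) < M"
  shows "collapsed_word M e (Suc v) (h + of_bool (\<not> p)) s"
  using assms(1)
proof cases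
  case (expandI T A B)
  then have "(e \<longleftrightarrow> 0 < T) \<longleftrightarrow> even (length A)"
    using limit_entry_parity[of M e v _ A T B] assms(2,3) by simp
  then show ?thesis
    using collapsed_word_expansion_iff[OF assms(3), of T p A e h B] expandI assms(2) by simp
qed

lemma expand_label_bounds_iff:
  assumes "collapsed_word M e v (h + of_bool p) (A @ T # B)" "\<bar>T\<bar> = M" "int v < M"
    and "w = limit_rank (h + of_bool p) A T - of_bool (p \<and> e)"
  shows "0 \<le> w \<and> w \<le> int h \<longleftrightarrow> (p \<longrightarrow> A \<noteq> [])"
  using limit_rank_bounds[OF count_limit_entries[OF assms(1,3)] assms(2)]
    limit_rank_first_iff[OF assms(1-3)] assms(3,4)
  by (cases p; cases e) auto

lemma expand_label_bounds:
  assumes "expand M e v h s' p w s" "collapsed_word M e v (h + of_bool p) s'" "int v < M"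
  shows "0 \<le> w \<and> w \<le> int h"
  using assms(1)
proof cases
  case (expandI T A B)
  then show ?thesis
    using expand_label_bounds_iff[of M e v h p A T B w] assms(2,3) by simp
qed

lemma expand_unique:
  assumes "expand M e v h s' p w s1" "expand M e v h s' p w s2"
    and "collapsed_word M e v (h + of_bool p) s'" "int v < M"
  shows "s1 = s2"
  using assms(1)
proof cases
  case left: (expandI T1 A1 B1)
  from assms(2) show ?thesis
  proof cases
    case right: (expandI T2 A2 B2)
    have "A1 = A2 \<and> T1 = T2 \<and> B1 = B2"
      using limit_rank_unique[OF count_limit_entries[OF assms(3,4)], of A1 T1 B1 A2 T2 B2]
        left right assms(4)
      by simp
    then show ?thesis using left right by simp
  qed
qed

lemma expand_exists:
  assumes "collapsed_word M e v (h + of_bool p) s'" "int v < M" "0 \<le> w" "w \<le> int h"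
  obtains s where "expand M e v h s' p w s"
proof -
  have "0 \<le> w + of_bool (p \<and> e)" "w + of_bool (p \<and> e) \<le> int (h + of_bool p)" "0 < M"
    using assms(2-4) by auto
  then obtain A T B where s': "s' = A @ T # B" and T: "\<bar>T\<bar> = M"
    and rank: "limit_rank (h + of_bool p) A T = w + of_bool (p \<and> e)"
    by (metis limit_rank_exists[OF count_limit_entries[OF assms(1,2)]])
  then have "p \<longrightarrow> A \<noteq> []"
    using expand_label_bounds_iff[of M e v h p A T B w] assms by simp
  then show ?thesis
    using that expand.expandI[OF T, of p A e v h B] unfolding s' rank by simp
qed

section \<open>Collapsing\<close>

lemma split_limit_neighbours:
  assumes "collapsed_word M e (Suc v) y (A @ x # B)" "\<bar>x\<bar> = int (Suc v)" "int (Suc v) < M"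
    and inner: "(0 < x) \<noteq> (e = even (length A))"
  obtains A' B' where "A = A' @ [sgn x * M]" "B = sgn x * M # B'"
proof -
  have alt: "alternating e (A @ x # B)" and "\<bar>hd (A @ x # B)\<bar> = M"
    using assms(1) by (auto simp: collapsed_word_def)
  then have "A \<noteq> []" using assms(2,3) by auto
  then obtain A' a where A: "A = A' @ [a]" by (meson rev_exhaust)
  have "B \<noteq> []" using alternating_next[OF alt] inner assms(2) by (auto split: if_splits)
  then obtain b B' where B: "B = b # B'" by (cases B) auto
  have "if 0 < x then x < a \<and> x < b else a < x \<and> b < x"
    using alternating_neighbours[of e A' a x B] alt inner A B by (auto split: if_splits)
  moreover have "\<bar>a\<bar> = M \<or> \<bar>a\<bar> \<le> int (Suc v)" "\<bar>b\<bar> = M \<or> \<bar>b\<bar> \<le> int (Suc v)"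
    using collapsed_word_abs[OF assms(1)] A B by auto
  ultimately have "a = sgn x * M" "b = sgn x * M"
    using assms(2) by (auto simp: sgn_if split: if_splits)
  then show ?thesis using that A B by simp
qed

lemma split_expansion:
  assumes "collapsed_word M e (Suc v) y s" "int (Suc v) < M"
  obtains A T B p where "s = A @ expansion (int (Suc v)) p T @ B" "\<bar>T\<bar> = M" "p \<longrightarrow> A \<noteq> []"
    "(e \<longleftrightarrow> 0 < T) \<longleftrightarrow> even (length A)"
proof -
  have "int (Suc v) \<in># mset_set {1..int (Suc v)} + replicate_mset (Suc y) M" by simp
  then have "int (Suc v) \<in># mset (map abs s)"
    using assms(1) unfolding collapsed_word_def by metis
  then obtain x where x: "x \<in> set s" "\<bar>x\<bar> = int (Suc v)" by auto
  then obtain A B where s: "s = A @ x # B" by (meson split_list)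
  let ?T = "sgn x * M"
  have T: "\<bar>?T\<bar> = M" "sgn ?T * int (Suc v) = x" "0 < ?T \<longleftrightarrow> 0 < x"
    using x(2) assms(2) by (auto simp: abs_mult sgn_mult sgn_if split: if_splits)
  show ?thesis
  proof (cases "(0 < x) = (e = even (length A))")
    case True
    have "A \<noteq> []" using assms x(2) s by (auto simp: collapsed_word_def)
    then show ?thesis
      using that[of A True ?T B] s T True by (auto simp: expansion_def)
  next
    case False
    then obtain A' B' where "A = A' @ [?T]" "B = ?T # B'"
      using split_limit_neighbours[of M e v y A x B] assms s x(2) by blast
    then show ?thesis
      using that[of A' False ?T B'] s T False by (auto simp: expansion_def)
  qed
qed

lemma collapse_exists:
  assumes "collapsed_word M e (Suc v) y s" "int (Suc v) < M"
  obtains s' p w h where "y = h + of_bool (\<not> p)" "expand M e v h s' p w s"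
    "collapsed_word M e v (h + of_bool p) s'"
proof -
  obtain A T B p where s: "s = A @ expansion (int (Suc v)) p T @ B" and T: "\<bar>T\<bar> = M"
    and p: "p \<longrightarrow> A \<noteq> []" and parity: "(e \<longleftrightarrow> 0 < T) \<longleftrightarrow> even (length A)"
    using split_expansion[OF assms] by metis
  have "of_bool (\<not> p) \<le> y"
    using count_limit_entries[OF assms] s T assms(2)
    by (cases p) (auto simp: expansion_def abs_if split: if_splits)
  then obtain h where h: "y = h + of_bool (\<not> p)" by (metis le_add_diff_inverse2)
  have "expand M e v h (A @ T # B) p (limit_rank (h + of_bool p) A T - of_bool (p \<and> e)) s"
    unfolding s using T p by (rule expand.expandI)
  moreover have "collapsed_word M e v (h + of_bool p) (A @ T # B)"
    using collapsed_word_expansion_iff[OF assms(2) T p parity] assms(1)[unfolded s h] by blast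
  ultimately show ?thesis using that h by blast
qed

section \<open>Codes of entries\<close>

definition before :: "'a \<Rightarrow> 'a list \<Rightarrow> 'a list" where
  "before x s = takeWhile (\<lambda>z. z \<noteq> x) s"

text \<open>The tail drops the additional limit entry; the remaining entries are paired as in the
  definition of the inversion code, for either parity of \<open>n\<close>.\<close>

definition crossing_code :: "'a::linorder \<Rightarrow> 'a list \<Rightarrow> nat" where
  "crossing_code x s = unequal_pairs (map (\<lambda>z. x < z) (tl (before x s)))"

definition upward :: "bool \<Rightarrow> 'a::{ord,zero} \<Rightarrow> 'a list \<Rightarrow> bool" where
  "upward e x s \<longleftrightarrow> (0 < x) = (even (length (before x s)) = e)"

definition signed_entry :: "'a::uminus \<Rightarrow> 'a list \<Rightarrow> 'a" where
  "signed_entry k s = (if k \<in> set s then k else - k)"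

lemma before_append_notin: "x \<notin> set A \<Longrightarrow> before x (A @ B) = A @ before x B"
  unfolding before_def by (induction A) auto

lemma before_append_in: "x \<in> set A \<Longrightarrow> before x (A @ B) = before x A"
  unfolding before_def by (induction A) auto

lemma before_Cons: "before x (a # B) = (if x = a then [] else a # before x B)"
  unfolding before_def by simp

lemma signed_entry_expansion:
  fixes T :: "'a::linordered_idom"
  assumes "0 < k" "T \<noteq> 0" "\<forall>z\<in>set (A @ T # B). \<bar>z\<bar> \<noteq> k"
  shows "signed_entry k (A @ expansion k p T @ B) = sgn T * k"
proof -
  have "\<bar>k\<bar> = k" using assms(1) by simp
  then have "k \<notin> set (A @ T # B)" using assms(3) by blast
  then show ?thesis
    using assms(1,2) by (cases "0 < T") (auto simp: signed_entry_def expansion_def)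
qed

lemma before_expansion:
  fixes T :: "'a::linordered_idom"
  assumes "0 < k" "T \<noteq> 0" "\<forall>z\<in>set (A @ T # B). \<bar>z\<bar> \<noteq> k"
  shows "before (sgn T * k) (A @ expansion k p T @ B) = A @ (if p then [] else [T])"
proof -
  have "\<bar>sgn T * k\<bar> = k" using assms(1,2) by (simp add: abs_mult)
  then have "sgn T * k \<notin> set (A @ T # B)" using assms(3) by blast
  then show ?thesis by (auto simp: expansion_def before_append_notin before_Cons)
qed

lemma crossing_code_expansion:
  assumes word: "collapsed_word M e v y (A @ T # B)" and T: "\<bar>T\<bar> = M" and "p \<longrightarrow> A \<noteq> []"
    and M: "int (Suc v) < M"
  shows "int (crossing_code (sgn T * int (Suc v)) (A @ expansion (int (Suc v)) p T @ B)) =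
    int (count_list A T) - of_bool (p \<and> e = (0 < T))"
proof -
  let ?A = "A @ (if p then [] else [T])" and ?x = "sgn T * int (Suc v)"
  have bounded: "\<bar>z\<bar> = \<bar>T\<bar> \<or> \<bar>z\<bar> < int (Suc v)" if "z \<in> set (A @ T # B)" for z
    using collapsed_word_abs[OF word that] T by auto
  have "T \<noteq> 0" using T M by auto
  have "\<forall>z\<in>set (A @ T # B). \<bar>z\<bar> \<noteq> int (Suc v)" using bounded T M by fastforce
  then have "crossing_code ?x (A @ expansion (int (Suc v)) p T @ B) =
      unequal_pairs (map (\<lambda>z. ?x < z) (tl ?A))"
    unfolding crossing_code_def using before_expansion[of "int (Suc v)" T A B p] \<open>T \<noteq> 0\<close> by simp
  also have "\<dots> = unequal_pairs (map (\<lambda>z. z = T) (tl ?A))"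
  proof (rule unequal_pairs_less_limit)
    have "set (tl ?A) \<subseteq> set (A @ T # B)" by (cases A) auto
    then show "\<forall>z\<in>set (tl ?A). \<bar>z\<bar> = \<bar>T\<bar> \<or> \<bar>z\<bar> < int (Suc v)" using bounded by blast
  qed (use T M in auto)
  also have "int \<dots> = int (count_list A T) - of_bool (p \<and> e = (0 < T))"
  proof (rule unequal_pairs_before_extremal)
    show "alternating e (A @ T # B)" using word by (simp add: collapsed_word_def)
    show "\<forall>z\<in>set (A @ T # B). \<bar>z\<bar> \<le> \<bar>T\<bar>" using bounded T M by fastforce
    obtain r where "A @ T # B = (if e then M else - M) # r"
      using collapsed_word_Cons[OF word] M by auto
    then show "hd (A @ [T]) = (if e then \<bar>T\<bar> else - \<bar>T\<bar>)" using T by (cases A) auto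
  qed (use \<open>T \<noteq> 0\<close> assms(3) in auto)
  finally show ?thesis .
qed

lemma expand_new_entry:
  assumes "expand M e v h s' p w s" "collapsed_word M e v (h + of_bool p) s'" "int (Suc v) < M"
  defines "x \<equiv> signed_entry (int (Suc v)) s"
  shows "upward e x s = p"
    and "(if 0 < x then int (crossing_code x s) else int h - int (crossing_code x s)) = w"
proof -
  from assms(1) obtain T A B where s': "s' = A @ T # B" and T: "\<bar>T\<bar> = M" and p: "p \<longrightarrow> A \<noteq> []"
    and w: "w = limit_rank (h + of_bool p) A T - of_bool (p \<and> e)"
    and s: "s = A @ expansion (int (Suc v)) p T @ B"
    by cases
  have "T \<noteq> 0" using T assms(3) by auto
  have new: "\<forall>z\<in>set (A @ T # B). \<bar>z\<bar> \<noteq> int (Suc v)"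
    using collapsed_word_abs[OF assms(2)] assms(3) unfolding s' by fastforce
  have x: "x = sgn T * int (Suc v)"
    unfolding x_def s using \<open>T \<noteq> 0\<close> new by (intro signed_entry_expansion) auto
  have sign: "0 < x \<longleftrightarrow> 0 < T" using \<open>T \<noteq> 0\<close> by (auto simp: x sgn_if)
  have before: "before x s = A @ (if p then [] else [T])"
    unfolding x s using \<open>T \<noteq> 0\<close> new by (intro before_expansion) auto
  have "(e \<longleftrightarrow> 0 < T) \<longleftrightarrow> even (length A)"
    using limit_entry_parity[of M e v _ A T B] assms(2,3) s' T by simp
  then show "upward e x s = p"
    unfolding upward_def before using sign by auto
  have "int (crossing_code x s) = int (count_list A T) - of_bool (p \<and> e = (0 < T))"
    using crossing_code_expansion[OF assms(2)[unfolded s'] T p assms(3)] by (simp only: x s)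
  then show "(if 0 < x then int (crossing_code x s) else int h - int (crossing_code x s)) = w"
    using sign by (auto simp: w limit_rank_def)
qed

lemma expand_stable:
  assumes "expand M e v h s' p w s" "int (Suc v) < M" "\<bar>x\<bar> \<le> int v"
  shows "crossing_code x s = crossing_code x s'" "upward e x s = upward e x s'"
    and "x \<in> set s \<longleftrightarrow> x \<in> set s'"
proof -
  from assms(1) obtain T A B where s': "s' = A @ T # B" and T: "\<bar>T\<bar> = M" and p: "p \<longrightarrow> A \<noteq> []"
    and s: "s = A @ expansion (int (Suc v)) p T @ B"
    by cases
  let ?E = "expansion (int (Suc v)) p T"
  have x: "x \<noteq> T" "x \<notin> set ?E"
    using assms(2,3) T by (auto simp: expansion_def sgn_if)
  then show "x \<in> set s \<longleftrightarrow> x \<in> set s'" by (auto simp: s s')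
  have map_less: "map (\<lambda>z. x < z) ?E = (if p then [x < T] else [x < T, x < T, x < T])"
    using assms(2,3) T by (auto simp: expansion_def sgn_if)
  have before: "before x s = A @ ?E @ before x B" "before x s' = A @ T # before x B" if "x \<notin> set A"
    using that x by (simp_all add: s s' before_append_notin before_Cons)
  have before_eq: "before x s = before x s'" if "x \<in> set A"
    using that by (simp add: s s' before_append_in)
  show "upward e x s = upward e x s'"
  proof (cases "x \<in> set A")
    case False
    then show ?thesis unfolding upward_def before[OF False] by (simp add: expansion_def)
  qed (simp add: upward_def before_eq)
  show "crossing_code x s = crossing_code x s'"
  proof (cases "x \<in> set A")
    case False
    have "unequal_pairs (map (\<lambda>z. x < z) (tl (A @ ?E @ before x B))) =
        unequal_pairs (map (\<lambda>z. x < z) (tl (A @ T # before x B)))"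
    proof (cases A)
      case Nil
      then show ?thesis using p map_less by (simp add: expansion_def)
    next
      case (Cons a A')
      then show ?thesis using map_less by (simp add: unequal_pairs_triple)
    qed
    then show ?thesis unfolding crossing_code_def before[OF False] .
  qed (simp add: crossing_code_def before_eq)
qed

section \<open>The bijection for collapsed words\<close>

fun encode :: "bool \<Rightarrow> int \<Rightarrow> nat \<Rightarrow> int list \<Rightarrow> (bool \<times> int) list" where
  "encode e y 0 s = []"
| "encode e y (Suc v) s =
     (let x = signed_entry (int (Suc v)) s; p = upward e x s; h = y - of_bool (\<not> p)
      in (p, if 0 < x then int (crossing_code x s) else h - int (crossing_code x s)) #
         encode e (h + of_bool p) v s)"

fun labeled_steps :: "int \<Rightarrow> (bool \<times> int) list \<Rightarrow> bool" where
  "labeled_steps y [] \<longleftrightarrow> 0 \<le> y"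
| "labeled_steps y ((p, w) # q) \<longleftrightarrow>
     0 \<le> w \<and> w \<le> y - of_bool (\<not> p) \<and> labeled_steps (y + (if p then 1 else - 1)) q"

lemma length_encode [simp]: "length (encode e y v s) = v"
  by (induction v arbitrary: y) (auto simp: Let_def)

lemma encode_cong:
  assumes "\<And>x. \<bar>x\<bar> \<le> int v \<Longrightarrow> crossing_code x s = crossing_code x s' \<and>
    upward e x s = upward e x s' \<and> (x \<in> set s \<longleftrightarrow> x \<in> set s')"
  shows "encode e y v s = encode e y v s'"
  using assms
proof (induction v arbitrary: y)
  case (Suc v)
  have "signed_entry (int (Suc v)) s = signed_entry (int (Suc v)) s'"
    using Suc.prems[of "int (Suc v)"] by (simp add: signed_entry_def)
  moreover have "\<bar>signed_entry (int (Suc v)) s'\<bar> \<le> int (Suc v)" by (simp add: signed_entry_def)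
  ultimately show ?case using Suc.IH Suc.prems by (simp add: Let_def)
qed simp

lemma encode_expand:
  assumes "expand M e v h s' p w s" "collapsed_word M e v (h + of_bool p) s'" "int (Suc v) < M"
  shows "encode e (int (h + of_bool (\<not> p))) (Suc v) s =
    (p, w) # encode e (int (h + of_bool p)) v s'"
proof -
  have "encode e y v s = encode e y v s'" for y
    using expand_stable[OF assms(1,3)] by (intro encode_cong) blast
  then show ?thesis
    using expand_new_entry[OF assms] by (auto simp: Let_def split: if_splits)
qed

lemma encode_inject:
  assumes "collapsed_word M e v y s1" "collapsed_word M e v y s2" "int v < M"
    and "encode e (int y) v s1 = encode e (int y) v s2"
  shows "s1 = s2"
  using assms
proof (induction v arbitrary: y s1 s2)
  case 0
  then show ?case using collapsed_word_zero_iff[of M e y] by simp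
next
  case (Suc v)
  obtain s1' p w h where left: "y = h + of_bool (\<not> p)" "expand M e v h s1' p w s1"
    "collapsed_word M e v (h + of_bool p) s1'"
    using collapse_exists[OF Suc.prems(1,3)] .
  obtain s2' p' w' h' where right: "y = h' + of_bool (\<not> p')" "expand M e v h' s2' p' w' s2"
    "collapsed_word M e v (h' + of_bool p') s2'"
    using collapse_exists[OF Suc.prems(2,3)] .
  have "(p, w) # encode e (int (h + of_bool p)) v s1' =
      (p', w') # encode e (int (h' + of_bool p')) v s2'"
    using encode_expand[OF left(2,3) Suc.prems(3)] encode_expand[OF right(2,3) Suc.prems(3)]
      Suc.prems(4) left(1) right(1) by metis
  then have same: "p' = p" "w' = w"
    "encode e (int (h + of_bool p)) v s1' = encode e (int (h' + of_bool p)) v s2'"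
    by auto
  moreover have "h' = h" using left(1) right(1) same(1) by simp
  moreover have "int v < M" using Suc.prems(3) by simp
  ultimately have "s1' = s2'" using Suc.IH[OF left(3), of s2'] right(3) by simp
  then show ?case
    using expand_unique[OF left(2) _ left(3) \<open>int v < M\<close>] right(2) same \<open>h' = h\<close> by simp
qed

lemma labeled_steps_encode:
  assumes "collapsed_word M e v y s" "int v < M"
  shows "labeled_steps (int y) (encode e (int y) v s)"
  using assms
proof (induction v arbitrary: y s)
  case (Suc v)
  obtain s' p w h where step: "y = h + of_bool (\<not> p)" "expand M e v h s' p w s"
    "collapsed_word M e v (h + of_bool p) s'"
    using collapse_exists[OF Suc.prems] .
  have "int v < M" using Suc.prems(2) by simp
  have "labeled_steps (int (h + of_bool p)) (encode e (int (h + of_bool p)) v s')"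
    using Suc.IH[OF step(3)] \<open>int v < M\<close> .
  then show ?case
    unfolding step(1) encode_expand[OF step(2,3) Suc.prems(2)]
    using expand_label_bounds[OF step(2,3) \<open>int v < M\<close>] by (cases p) (simp_all add: add.commute)
qed simp

lemma encode_surj:
  assumes "labeled_steps (int y) q" "int (length q) < M" "e = even (length q + y)"
  obtains s where "collapsed_word M e (length q) y s" "encode e (int y) (length q) s = q"
proof -
  have "\<exists>s. collapsed_word M e (length q) y s \<and> encode e (int y) (length q) s = q"
    using assms
  proof (induction q arbitrary: y)
    case Nil
    then show ?case using collapsed_word_zero_iff[of M e y] by simp
  next
    case (Cons a q)
    obtain p w where a: "a = (p, w)" by fastforce
    define h where "h = y - of_bool (\<not> p)"
    have bounds: "0 \<le> w" "w \<le> int h" and y: "y = h + of_bool (\<not> p)"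
      using Cons.prems(1) unfolding a h_def by (cases p; auto)+
    have M: "int (length q) < M" "int (Suc (length q)) < M" using Cons.prems(2) by auto
    obtain s' where s': "collapsed_word M e (length q) (h + of_bool p) s'"
      "encode e (int (h + of_bool p)) (length q) s' = q"
      using Cons.IH[of "h + of_bool p"] Cons.prems M unfolding a y
      by (cases p) (auto simp: add.commute)
    obtain s where s: "expand M e (length q) h s' p w s"
      using expand_exists[OF s'(1) M(1) bounds] .
    show ?case
      using expand_collapsed_word[OF s s'(1) M(2)] encode_expand[OF s s'(1) M(2)] s'(2) a y by auto
  qed
  then show ?thesis using that by blast
qed

lemma bij_betw_encode:
  assumes "int v < M" "e = even (v + y)"
  shows "bij_betw (encode e (int y) v) {s. collapsed_word M e v y s}
    {q. length q = v \<and> labeled_steps (int y) q}"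
proof (rule bij_betw_imageI)
  show "inj_on (encode e (int y) v) {s. collapsed_word M e v y s}"
    using encode_inject assms(1) by (auto intro: inj_onI)
  show "encode e (int y) v ` {s. collapsed_word M e v y s} =
      {q. length q = v \<and> labeled_steps (int y) q}"
  proof (intro equalityI subsetI)
    fix q assume "q \<in> {q. length q = v \<and> labeled_steps (int y) q}"
    then show "q \<in> encode e (int y) v ` {s. collapsed_word M e v y s}"
      using encode_surj[of y q M e] assms by (metis (mono_tags, lifting) image_eqI mem_Collect_eq)
  qed (use labeled_steps_encode assms(1) in auto)
qed

section \<open>Signed permutations\<close>

lemma signed_perm_iff_mset: "signed_perm n \<pi> \<longleftrightarrow> mset (map abs \<pi>) = mset_set {1..int n}"
proof
  assume "signed_perm n \<pi>"
  then show "mset (map abs \<pi>) = mset_set {1..int n}"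
    unfolding signed_perm_def by (metis mset_set_set)
next
  assume mset: "mset (map abs \<pi>) = mset_set {1..int n}"
  have "set (map abs \<pi>) = {1..int n}" using arg_cong[OF mset, of set_mset] by simp
  moreover have "length \<pi> = n" using arg_cong[OF mset, of size] by simp
  ultimately show "signed_perm n \<pi>"
    by (simp add: signed_perm_def card_distinct del: set_map)
qed

lemma signed_perm_abs_ent:
  assumes "signed_perm n \<pi>" "i \<in> {1..n}"
  shows "1 \<le> \<bar>ent \<pi> i\<bar>" "\<bar>ent \<pi> i\<bar> \<le> int n"
proof -
  have "\<bar>ent \<pi> i\<bar> \<in> set (map abs \<pi>)" using assms by (auto simp: ent_def signed_perm_def)
  then show "1 \<le> \<bar>ent \<pi> i\<bar>" "\<bar>ent \<pi> i\<bar> \<le> int n"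
    using assms(1) by (simp_all add: signed_perm_def del: set_map)
qed

lemma signed_perm_abs_ent_eq_iff:
  assumes "signed_perm n \<pi>" "i \<in> {1..n}" "j \<in> {1..n}"
  shows "\<bar>ent \<pi> i\<bar> = \<bar>ent \<pi> j\<bar> \<longleftrightarrow> i = j"
proof -
  have "distinct (map abs \<pi>)" and len: "length \<pi> = n" using assms(1) by (auto simp: signed_perm_def)
  then have "map abs \<pi> ! (i - 1) = map abs \<pi> ! (j - 1) \<longleftrightarrow> i - 1 = j - 1"
    using assms(2,3) by (subst nth_eq_iff_index_eq) auto
  then show ?thesis using assms(2,3) len by (auto simp: ent_def)
qed

lemma set_signed_perm:
  assumes "signed_perm n \<pi>"
  shows "set \<pi> = ent \<pi> ` {1..n}"
proof -
  have "length \<pi> = n" using assms by (simp add: signed_perm_def)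
  then have "set \<pi> = (\<lambda>k. ent \<pi> (Suc k)) ` {..<n}" by (auto simp: ent_def set_conv_nth)
  also have "\<dots> = ent \<pi> ` Suc ` {..<n}" by (simp add: image_image)
  also have "Suc ` {..<n} = {1..n}" by (simp add: image_Suc_lessThan)
  finally show ?thesis .
qed

lemma signed_perm_position:
  assumes "signed_perm n \<pi>" "k \<in> {1..int n}"
  obtains i where "i \<in> {1..n}" "\<bar>ent \<pi> i\<bar> = k"
proof -
  have "k \<in> abs ` ent \<pi> ` {1..n}"
    using assms set_signed_perm[OF assms(1)] by (simp add: signed_perm_def)
  then show ?thesis using that by blast
qed

lemma posn_ent:
  assumes "signed_perm n \<pi>" "i \<in> {1..n}"
  shows "posn \<pi> \<bar>ent \<pi> i\<bar> = i"
  unfolding posn_def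
proof (rule the_equality)
  have len: "length \<pi> = n" using assms(1) by (simp add: signed_perm_def)
  show "1 \<le> i \<and> i \<le> length \<pi> \<and> \<bar>ent \<pi> i\<bar> = \<bar>ent \<pi> i\<bar>" using assms(2) len by simp
  show "j = i" if "1 \<le> j \<and> j \<le> length \<pi> \<and> \<bar>ent \<pi> j\<bar> = \<bar>ent \<pi> i\<bar>" for j
    using that signed_perm_abs_ent_eq_iff[OF assms(1), of j i] assms(2) len by simp
qed

section \<open>Snakes as words with one limit entry\<close>

definition snake_word :: "nat \<Rightarrow> int list \<Rightarrow> int list" where
  "snake_word n \<pi> = (if even n then int n + 1 else - (int n + 1)) # rev \<pi>"

lemma alternating_snake_word_iff:
  assumes "signed_perm n \<pi>" "n \<ge> 1"
  shows "alternating (even n) (snake_word n \<pi>) \<longleftrightarrow> snake n \<pi>"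
proof -
  define limit where "limit = (if even n then int n + 1 else - (int n + 1))"
  define alternates where "alternates j \<longleftrightarrow>
      (if even j then (0 # \<pi> @ [limit]) ! j < (\<pi> @ [limit]) ! j
       else (\<pi> @ [limit]) ! j < (0 # \<pi> @ [limit]) ! j)" for j
  have len: "length \<pi> = n" using assms(1) by (simp add: signed_perm_def)
  have first: "alternates 0 \<longleftrightarrow> 0 < ent \<pi> 1"
    using assms(2) len by (simp add: alternates_def ent_def nth_append)
  have inner: "alternates j \<longleftrightarrow>
      (if odd j then ent \<pi> j > ent \<pi> (j + 1) else ent \<pi> j < ent \<pi> (j + 1))"
    if "1 \<le> j" "j < n" for j
    using that len by (cases j) (simp_all add: alternates_def ent_def nth_append)
  have "(0 # \<pi> @ [limit]) ! n = ent \<pi> n" "(\<pi> @ [limit]) ! n = limit"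
    using assms(2) len by (cases n; simp add: ent_def nth_append)+
  then have last: "alternates n"
    using signed_perm_abs_ent[OF assms(1), of n] assms(2) by (auto simp: alternates_def limit_def)
  have "snake_word n \<pi> = rev (\<pi> @ [limit])" by (simp add: snake_word_def limit_def)
  then have "alternating (even n) (snake_word n \<pi>) \<longleftrightarrow> (\<forall>j<Suc n. alternates j)"
    using len by (simp add: alternating_rev_iff alternates_def del: rev_append)
  also have "\<dots> \<longleftrightarrow> alternates 0 \<and> (\<forall>j. 1 \<le> j \<and> j < n \<longrightarrow> alternates j)"
    using last by (metis One_nat_def Suc_le_eq less_Suc_eq neq0_conv zero_less_Suc)
  finally show ?thesis using assms first inner by (simp add: snake_def)
qed

lemma collapsed_snake_word_iff:
  assumes "n \<ge> 1"
  shows "collapsed_word (int n + 1) (even n) n 0 (snake_word n \<pi>) \<longleftrightarrow> snake n \<pi>"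
proof -
  have "mset (map abs (snake_word n \<pi>)) = mset_set {1..int n} + replicate_mset (Suc 0) (int n + 1) \<longleftrightarrow>
      signed_perm n \<pi>"
    by (simp add: signed_perm_iff_mset snake_word_def add.commute)
  moreover have "\<bar>hd (snake_word n \<pi>)\<bar> = int n + 1" by (simp add: snake_word_def)
  moreover have "snake n \<pi> \<Longrightarrow> signed_perm n \<pi>" by (simp add: snake_def)
  ultimately show ?thesis
    unfolding collapsed_word_def using alternating_snake_word_iff[OF _ assms] by blast
qed

lemma bij_betw_snake_word:
  assumes "n \<ge> 1"
  shows "bij_betw (snake_word n) {\<pi>. snake n \<pi>} {s. collapsed_word (int n + 1) (even n) n 0 s}"
proof (rule bij_betw_imageI)
  show "inj_on (snake_word n) {\<pi>. snake n \<pi>}" by (auto simp: inj_on_def snake_word_def)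
  show "snake_word n ` {\<pi>. snake n \<pi>} = {s. collapsed_word (int n + 1) (even n) n 0 s}"
  proof (intro equalityI subsetI)
    fix s assume "s \<in> {s. collapsed_word (int n + 1) (even n) n 0 s}"
    then have s: "collapsed_word (int n + 1) (even n) n 0 s" by simp
    obtain r where "s = (if even n then int n + 1 else - (int n + 1)) # r"
      using collapsed_word_Cons[OF s] by auto
    then have "s = snake_word n (rev r)" by (simp add: snake_word_def)
    then show "s \<in> snake_word n ` {\<pi>. snake n \<pi>}"
      using s collapsed_snake_word_iff[OF assms] by blast
  qed (use collapsed_snake_word_iff[OF assms] in auto)
qed

lemma signed_entry_snake_word:
  assumes "signed_perm n \<pi>" "i \<in> {1..n}"
  shows "signed_entry \<bar>ent \<pi> i\<bar> (snake_word n \<pi>) = ent \<pi> i"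
proof (cases "0 < ent \<pi> i")
  case True
  then show ?thesis
    using assms set_signed_perm by (simp add: signed_entry_def snake_word_def)
next
  case False
  have "\<bar>ent \<pi> i\<bar> \<notin> set \<pi>"
  proof
    assume "\<bar>ent \<pi> i\<bar> \<in> set \<pi>"
    then obtain j where j: "j \<in> {1..n}" "ent \<pi> j = \<bar>ent \<pi> i\<bar>"
      using set_signed_perm[OF assms(1)] by auto
    then have "j = i" using signed_perm_abs_ent_eq_iff[OF assms(1) j(1) assms(2)] by simp
    then show False using j(2) False signed_perm_abs_ent[OF assms] by simp
  qed
  then have "\<bar>ent \<pi> i\<bar> \<notin> set (snake_word n \<pi>)"
    using signed_perm_abs_ent[OF assms] by (auto simp: snake_word_def)
  then show ?thesis using False by (simp add: signed_entry_def)
qed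

lemma before_snake_word:
  assumes "signed_perm n \<pi>" "i \<in> {1..n}"
  shows "before (ent \<pi> i) (snake_word n \<pi>) =
    (if even n then int n + 1 else - (int n + 1)) # rev (drop i \<pi>)"
proof -
  have len: "length \<pi> = n" and dist: "distinct \<pi>"
    using assms(1) by (auto simp: signed_perm_def distinct_map)
  have "i - 1 < length \<pi>" "Suc (i - 1) = i" using assms(2) len by auto
  then have \<pi>: "\<pi> = take (i - 1) \<pi> @ ent \<pi> i # drop i \<pi>"
    unfolding ent_def by (metis id_take_nth_drop)
  have "ent \<pi> i \<notin> set (drop i \<pi>)" using dist by (subst (asm) \<pi>) simp
  moreover have "rev \<pi> = rev (drop i \<pi>) @ ent \<pi> i # rev (take (i - 1) \<pi>)"
    by (subst \<pi>) simp
  ultimately show ?thesis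
    using signed_perm_abs_ent[OF assms]
    by (auto simp: snake_word_def before_Cons before_append_notin)
qed

lemma upward_snake_word:
  assumes "signed_perm n \<pi>" "i \<in> {1..n}"
  shows "upward (even n) (ent \<pi> i) (snake_word n \<pi>) = (if 0 < ent \<pi> i then odd i else even i)"
proof -
  have "length \<pi> = n" using assms(1) by (simp add: signed_perm_def)
  then have "length (before (ent \<pi> i) (snake_word n \<pi>)) = Suc (n - i)"
    using before_snake_word[OF assms] by simp
  then show ?thesis using assms(2) by (auto simp: upward_def)
qed

section \<open>The inversion code\<close>

lemma unequal_pairs_rev_drop:
  "unequal_pairs (rev (drop i xs)) =
    card {j. i < j \<and> j < length xs \<and> odd (length xs - j) \<and> xs ! j \<noteq> xs ! (j - 1)}"
    (is "_ = card ?J")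
proof -
  let ?f = "\<lambda>m. length xs - Suc m"
  have nth: "rev (drop i xs) ! m = xs ! ?f m" if "m < length xs - i" for m
    using that by (simp add: rev_nth)
  have "unequal_pairs (rev (drop i xs)) =
      card {m. Suc m < length xs - i \<and> even m \<and> xs ! ?f m \<noteq> xs ! ?f (Suc m)}" (is "_ = card ?M")
    unfolding unequal_pairs_eq_card by (rule arg_cong[of _ _ card]) (auto simp: nth)
  also have "\<dots> = card ?J"
  proof (rule bij_betw_same_card[OF bij_betw_byWitness[where f = ?f and f' = ?f]])
    show "?f ` ?M \<subseteq> ?J"
    proof (rule image_subsetI)
      fix m assume m: "m \<in> ?M"
      then have eq: "?f m - 1 = ?f (Suc m)" "length xs - ?f m = Suc m"
        and less: "i < ?f m" "?f m < length xs" by auto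
      show "?f m \<in> ?J" unfolding mem_Collect_eq eq using m less by simp
    qed
    show "?f ` ?J \<subseteq> ?M"
    proof (rule image_subsetI)
      fix j assume j: "j \<in> ?J"
      then have eq: "?f (?f j) = j" "?f (Suc (?f j)) = j - 1"
        and step: "Suc (?f j) = length xs - j" "Suc (?f j) < length xs - i" by auto
      have "odd (Suc (?f j))" unfolding step(1) using j by simp
      then show "?f j \<in> ?M" unfolding mem_Collect_eq eq using j step(2) by simp
    qed
  qed auto
  finally show ?thesis .
qed

lemma snake_crossing_iff:
  assumes "snake n \<pi>" "1 \<le> i" "i < j" "j < n"
  shows "(ent \<pi> i < ent \<pi> (j + 1)) \<noteq> (ent \<pi> i < ent \<pi> j) \<longleftrightarrow>
    (if odd j then ent \<pi> (j + 1) < ent \<pi> i \<and> ent \<pi> i < ent \<pi> j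
     else ent \<pi> j < ent \<pi> i \<and> ent \<pi> i < ent \<pi> (j + 1))"
proof -
  have "signed_perm n \<pi>" using assms(1) by (simp add: snake_def)
  then have "ent \<pi> i \<noteq> ent \<pi> j" "ent \<pi> i \<noteq> ent \<pi> (j + 1)"
    using signed_perm_abs_ent_eq_iff[of n \<pi> i j] signed_perm_abs_ent_eq_iff[of n \<pi> i "j + 1"]
      assms(2-4)
    by auto
  moreover have "if odd j then ent \<pi> j > ent \<pi> (j + 1) else ent \<pi> j < ent \<pi> (j + 1)"
  proof -
    have "1 \<le> j" using assms(2,3) by simp
    then show ?thesis using assms(1,4) unfolding snake_def by blast
  qed
  ultimately show ?thesis by (auto split: if_splits)
qed

lemma inv_code_eq_card:
  assumes "snake n \<pi>" "1 \<le> i"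
  shows "inv_code n \<pi> i = card {j. i < j \<and> j < n \<and> odd (n - j) \<and>
    (ent \<pi> i < ent \<pi> (j + 1)) \<noteq> (ent \<pi> i < ent \<pi> j)}" (is "_ = card ?J")
proof (cases "odd n")
  case True
  let ?K = "{k. 1 \<le> k \<and> k \<le> (n - 1) div 2 \<and> i < 2 * k \<and>
    ent \<pi> (2 * k) < ent \<pi> i \<and> ent \<pi> i < ent \<pi> (2 * k + 1)}"
  have "?J = (\<lambda>k. 2 * k) ` ?K"
  proof (intro equalityI subsetI)
    fix j assume j: "j \<in> ?J"
    then obtain k where k: "j = 2 * k" using True by (auto elim: evenE)
    then have "k \<in> ?K" using j snake_crossing_iff[OF assms, of j] by auto
    then show "j \<in> (\<lambda>k. 2 * k) ` ?K" using k by blast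
  next
    fix j assume "j \<in> (\<lambda>k. 2 * k) ` ?K"
    then obtain k where k: "k \<in> ?K" "j = 2 * k" by blast
    then have "j < n" using True by auto
    then show "j \<in> ?J" using k True by auto
  qed
  then show ?thesis using True by (simp add: inv_code_def card_image inj_on_def)
next
  case False
  let ?K = "{k. 1 \<le> k \<and> k \<le> n div 2 \<and> i < 2 * k - 1 \<and>
    ent \<pi> (2 * k) < ent \<pi> i \<and> ent \<pi> i < ent \<pi> (2 * k - 1)}"
  have "?J = (\<lambda>k. 2 * k - 1) ` ?K"
  proof (intro equalityI subsetI)
    fix j assume j: "j \<in> ?J"
    then have "odd j" using False by auto
    then obtain k where k: "j = 2 * k + 1" by (elim oddE)
    have "Suc k \<in> ?K" using j snake_crossing_iff[OF assms, of j] \<open>odd j\<close> by (auto simp: k)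
    then show "j \<in> (\<lambda>k. 2 * k - 1) ` ?K" by (rule rev_image_eqI) (simp add: k)
  next
    fix j assume "j \<in> (\<lambda>k. 2 * k - 1) ` ?K"
    then obtain k where k: "k \<in> ?K" "j = 2 * k - 1" by blast
    then have "j < n" "odd j" "j + 1 = 2 * k" by auto
    then show "j \<in> ?J" using k False by auto
  qed
  moreover have "inj_on (\<lambda>k. 2 * k - 1) ?K" by (auto simp: inj_on_def)
  ultimately show ?thesis using False by (simp add: inv_code_def card_image)
qed

lemma crossing_code_snake_word:
  assumes "snake n \<pi>" "i \<in> {1..n}"
  shows "crossing_code (ent \<pi> i) (snake_word n \<pi>) = inv_code n \<pi> i"
proof -
  have perm: "signed_perm n \<pi>" using assms(1) by (simp add: snake_def)
  then have len: "length \<pi> = n" by (simp add: signed_perm_def)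
  have "1 \<le> i" using assms(2) by simp
  let ?above = "\<lambda>z. ent \<pi> i < z"
  have "crossing_code (ent \<pi> i) (snake_word n \<pi>) = unequal_pairs (rev (drop i (map ?above \<pi>)))"
    unfolding crossing_code_def before_snake_word[OF perm assms(2)] by (simp add: rev_map drop_map)
  also have "\<dots> = inv_code n \<pi> i"
    unfolding unequal_pairs_rev_drop inv_code_eq_card[OF assms(1) \<open>1 \<le> i\<close>]
    using \<open>1 \<le> i\<close> len by (intro arg_cong[of _ _ card]) (auto simp: ent_def)
  finally show ?thesis .
qed

section \<open>Labeled ballot paths\<close>

lemma ypos_0 [simp]: "ypos P 0 = 0"
  by (simp add: ypos_def)

lemma ypos_Cons: "ypos (p # P) (Suc k) = (if p then 1 else - 1) + ypos P k"
  unfolding ypos_def by (subst sum.lessThan_Suc_shift) simp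

lemma height_Cons_Suc_0: "height (p # P) (Suc 0) = - of_bool (\<not> p)"
  by (simp add: height_def ypos_Cons)

lemma height_Cons_Suc: "height (p # P) (Suc (Suc k)) = (if p then 1 else - 1) + height P (Suc k)"
  by (simp add: height_def ypos_Cons)

lemma height_take: "height (take k P) k = height P k"
proof -
  have "ypos (take k P) j = ypos P j" if "j \<le> k" for j
    unfolding ypos_def using that by (intro sum.cong) auto
  then show ?thesis by (simp add: height_def)
qed

lemma encode_nth:
  assumes "k < v" "P = map fst (encode e y v s)" "x = signed_entry (int (v - k)) s"
  shows "encode e y v s ! k = (upward e x s,
    if 0 < x then int (crossing_code x s) else y + height P (Suc k) - int (crossing_code x s))"
  using assms
proof (induction v arbitrary: y k P)
  case (Suc v)
  define x0 where "x0 = signed_entry (int (Suc v)) s"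
  define p where "p = upward e x0 s"
  define y' where "y' = y + (if p then 1 else - 1)"
  define P' where "P' = map fst (encode e y' v s)"
  have encode_Suc: "encode e y (Suc v) s = (p, if 0 < x0 then int (crossing_code x0 s)
      else y - of_bool (\<not> p) - int (crossing_code x0 s)) # encode e y' v s"
    by (auto simp: Let_def x0_def p_def y'_def)
  have path: "P = p # P'" using Suc.prems(2) unfolding encode_Suc P'_def by simp
  show ?case
  proof (cases k)
    case 0
    then show ?thesis
      using Suc.prems(3) by (simp add: encode_Suc path height_Cons_Suc_0 x0_def p_def del: encode.simps)
  next
    case (Suc k')
    have "y + height P (Suc k) = y' + height P' (Suc k')"
      by (simp add: path Suc height_Cons_Suc y'_def)
    then show ?thesis
      using Suc.IH[of k' P' y'] Suc.prems Suc by (simp add: encode_Suc P'_def del: encode.simps)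
  qed
qed simp

lemma labeled_steps_iff:
  "labeled_steps y q \<longleftrightarrow> (\<forall>k\<le>length q. 0 \<le> y + ypos (map fst q) k) \<and>
     (\<forall>k<length q. 0 \<le> snd (q ! k) \<and> snd (q ! k) \<le> y + height (map fst q) (Suc k))"
proof (induction q arbitrary: y)
  case (Cons a q)
  obtain p w where a: "a = (p, w)" by fastforce
  let ?y' = "y + (if p then 1 else - 1)"
  have "(\<forall>k\<le>length (a # q). 0 \<le> y + ypos (map fst (a # q)) k) \<longleftrightarrow>
      0 \<le> y \<and> (\<forall>k\<le>length q. 0 \<le> ?y' + ypos (map fst q) k)"
    unfolding length_Cons less_Suc_eq_le[symmetric] All_less_Suc2[of "Suc (length q)"]
    by (simp add: a ypos_Cons add.assoc)
  moreover have "(\<forall>k<length (a # q). 0 \<le> snd ((a # q) ! k) \<and>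
        snd ((a # q) ! k) \<le> y + height (map fst (a # q)) (Suc k)) \<longleftrightarrow>
      0 \<le> w \<and> w \<le> y - of_bool (\<not> p) \<and>
      (\<forall>k<length q. 0 \<le> snd (q ! k) \<and> snd (q ! k) \<le> ?y' + height (map fst q) (Suc k))"
    unfolding length_Cons All_less_Suc2[of "length q"]
    by (simp add: a height_Cons_Suc_0 height_Cons_Suc add.assoc)
  moreover have "0 \<le> w \<Longrightarrow> w \<le> y - of_bool (\<not> p) \<Longrightarrow> 0 \<le> y"
    by (cases p) auto
  ultimately show ?case
    using Cons.IH[of ?y'] unfolding a labeled_steps.simps by metis
qed simp

lemma labeled_ballot_path_iff:
  "labeled_ballot_path n (map fst q, map snd q) \<longleftrightarrow> length q = n \<and> labeled_steps 0 q"
proof -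
  have "(\<forall>k\<in>{1..n}. Q k) \<longleftrightarrow> (\<forall>k<n. Q (Suc k))" for Q
    unfolding image_Suc_lessThan[symmetric] by auto
  then show ?thesis
    unfolding labeled_ballot_path_def ballot_path_def labeled_steps_iff by auto
qed

lemma bij_betw_unzip:
  "bij_betw (\<lambda>q. (map fst q, map snd q)) {q. length q = n \<and> labeled_steps 0 q}
     {PW. labeled_ballot_path n PW}"
proof (rule bij_betw_imageI)
  show "inj_on (\<lambda>q. (map fst q, map snd q)) {q. length q = n \<and> labeled_steps 0 q}"
    by (rule inj_on_inverseI[where g = "\<lambda>(P, W). zip P W"]) (simp add: zip_map_fst_snd)
  have "PW \<in> range (\<lambda>q. (map fst q, map snd q))" if "labeled_ballot_path n PW" for PW
  proof -
    obtain P W where PW: "PW = (P, W)" by fastforce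
    then have "length P = length W"
      using that by (simp add: labeled_ballot_path_def ballot_path_def)
    then show ?thesis using PW by (intro range_eqI[of _ _ "zip P W"]) simp
  qed
  then show "(\<lambda>q. (map fst q, map snd q)) ` {q. length q = n \<and> labeled_steps 0 q} =
      {PW. labeled_ballot_path n PW}"
    by (auto simp: labeled_ballot_path_iff[symmetric])
qed

lemma Phi_eq_encode:
  assumes "snake n \<pi>"
  defines "q \<equiv> encode (even n) 0 n (snake_word n \<pi>)"
  shows "Phi n \<pi> = (map fst q, map snd q)"
proof -
  have perm: "signed_perm n \<pi>" using assms(1) by (simp add: snake_def)
  have step: "q ! k = (let i = posn \<pi> (int (n - (1 + k) + 1)) in
      (if 0 < ent \<pi> i then odd i else even i,
       if 0 < ent \<pi> i then int (inv_code n \<pi> i)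
       else height (map fst q) (1 + k) - int (inv_code n \<pi> i)))" if k: "k < n" for k
  proof -
    have "int (n - k) \<in> {1..int n}" using k by auto
    then obtain i where i: "i \<in> {1..n}" "\<bar>ent \<pi> i\<bar> = int (n - k)"
      using signed_perm_position[OF perm] by blast
    have entry_abs: "int (n - (1 + k) + 1) = \<bar>ent \<pi> i\<bar>" using k i(2) by simp
    have entry: "ent \<pi> i = signed_entry (int (n - k)) (snake_word n \<pi>)"
      using signed_entry_snake_word[OF perm i(1)] i(2) by simp
    show ?thesis
      unfolding entry_abs posn_ent[OF perm i(1)] Let_def
      using encode_nth[OF k refl entry, of "even n" 0] upward_snake_word[OF perm i(1)]
        crossing_code_snake_word[OF assms(1) i(1)]
      by (simp add: q_def)
  qed
  have len: "length q = n" by (simp add: q_def)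
  have path: "Phi_path n \<pi> = map fst q"
    by (rule nth_equalityI) (auto simp: Phi_path_def len step Let_def simp del: upt_Suc)
  have "snd (Phi n \<pi>) = map snd q"
    by (rule nth_equalityI)
      (auto simp: Phi_def path len step Let_def height_take simp del: upt_Suc)
  moreover have "fst (Phi n \<pi>) = map fst q" by (simp add: Phi_def path Let_def)
  ultimately show ?thesis by (metis prod.collapse)
qed

theorem theorem3p1:
  fixes n :: nat
  assumes "n \<ge> 1"
  shows "(\<forall>\<pi>. snake n \<pi> \<longrightarrow> labeled_ballot_path n (Phi n \<pi>)) \<and>
         bij_betw (Phi n) {\<pi>. snake n \<pi>} {PW. labeled_ballot_path n PW}"
proof -
  have "bij_betw (encode (even n) 0 n) {s. collapsed_word (int n + 1) (even n) n 0 s}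
      {q. length q = n \<and> labeled_steps 0 q}"
    using bij_betw_encode[of n "int n + 1" "even n" 0] by simp
  from bij_betw_trans[OF bij_betw_snake_word[OF assms] bij_betw_trans[OF this bij_betw_unzip]]
  have "bij_betw (Phi n) {\<pi>. snake n \<pi>} {PW. labeled_ballot_path n PW}"
    by (rule bij_betw_cong[THEN iffD1, rotated]) (simp add: Phi_eq_encode)
  then show ?thesis using bij_betwE by blast
qed

end
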